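(* Let $F$ be a field of characteristic $0$ and let $\mathcal{R}=\{J_a\circ l_r\mid a\in F,\ r\in F[x]\setminus\{0\}\}$. Let $\mathcal{H}$ be the group of bijections of $\mathcal{R}$ generated by all maps $h^b_s\colon J_a\circ l_r\mapsto J_a\circ l_{r+r(b)s}$, where $b\in F$ and $s\in F[x]$ with $s(b)=0$, and let $G_a$ be the group of bijections $J_a\circ l_{r(x)}\mapsto J_{a-\nu}\circ l_{r(x+\nu)}$ of $\mathcal{R}$, $\nu\in F$. Then the group $\langle G_a,\mathcal{H}\rangle$ generated by $G_a$ and $\mathcal{H}$ acts transitively on $\mathcal{R}$.
   Context: On $F[x]$: $l_r\colon f\mapsto rf$ is multiplication by $r\in F[x]$; for $a\in F$, $J_a$ is the linear operator with $J_a(x^n)=\frac{x^{n+1}-a^{n+1}}{n+1}$ for $n\ge0$; $\circ$ is composition. The map $(a,r)\mapsto J_a\circ l_r$ is a bijection $F\times(F[x]\setminus\{0\})\to\mathcal{R}$, so the maps above are well defined. The set $\mathcal{R}$ is the set of all injective Rota--Baxter operators of weight zero on $F[x]$ (injective linear operators $R$ with $R(f)R(g)=R(R(f)g+fR(g))$ for all $f,g$). *)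

theory Defs
  imports
    "HOL-Computational_Algebra.Polynomial"
    "HOL-Algebra.Group_Action"
    "HOL-Algebra.Generated_Groups"
begin

text \<open>Linear extension of \<open>x ^ n \<mapsto> (x ^ (n + 1) - a ^ (n + 1)) / (n + 1)\<close>.\<close>

definition J :: "'a::field_char_0 \<Rightarrow> 'a poly \<Rightarrow> 'a poly" where
  "J a f = (\<Sum>n\<le>degree f. smult (coeff f n)
     (smult (inverse (of_nat (n + 1))) (monom 1 (n + 1) - [:a ^ (n + 1):])))"

definition lmult :: "'a::field_char_0 poly \<Rightarrow> 'a poly \<Rightarrow> 'a poly" where
  "lmult r = (\<lambda>f. r * f)"

definition RB :: "('a::field_char_0 poly \<Rightarrow> 'a poly) set" where
  "RB = {J a \<circ> lmult r | a r. r \<noteq> 0}"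

text \<open>The parameters \<open>(a, r)\<close> of an element \<open>J a \<circ> lmult r\<close> of \<open>RB\<close>; they are unique by
  \<open>inj_on_RB_params\<close> below.\<close>

definition RB_params :: "('a::field_char_0 poly \<Rightarrow> 'a poly) \<Rightarrow> 'a \<times> 'a poly" where
  "RB_params = the_inv_into (UNIV \<times> (UNIV - {0})) (\<lambda>(a, r). J a \<circ> lmult r)"

definition h_map :: "'a::field_char_0 \<Rightarrow> 'a poly \<Rightarrow>
    ('a poly \<Rightarrow> 'a poly) \<Rightarrow> ('a poly \<Rightarrow> 'a poly)" where
  "h_map b s = (\<lambda>T\<in>RB. case RB_params T of (a, r) \<Rightarrow> J a \<circ> lmult (r + smult (poly r b) s))"

definition g_map :: "'a::field_char_0 \<Rightarrow>
    ('a poly \<Rightarrow> 'a poly) \<Rightarrow> ('a poly \<Rightarrow> 'a poly)" where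
  "g_map \<nu> = (\<lambda>T\<in>RB. case RB_params T of (a, r) \<Rightarrow> J (a - \<nu>) \<circ> lmult (pcompose r [:\<nu>, 1:]))"

definition H_group :: "(('a::field_char_0 poly \<Rightarrow> 'a poly) \<Rightarrow> ('a poly \<Rightarrow> 'a poly)) set" where
  "H_group = generate (BijGroup RB) {h_map b s | b s. poly s b = 0}"

definition Ga_group :: "(('a::field_char_0 poly \<Rightarrow> 'a poly) \<Rightarrow> ('a poly \<Rightarrow> 'a poly)) set" where
  "Ga_group = range g_map"

definition GH_group :: "(('a::field_char_0 poly \<Rightarrow> 'a poly) \<Rightarrow> ('a poly \<Rightarrow> 'a poly)) monoid" where
  "GH_group = (BijGroup RB)\<lparr>carrier := generate (BijGroup RB) (Ga_group \<union> H_group)\<rparr>"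


subsection \<open>The maps are well defined bijections\<close>

lemma pderiv_sum_poly: "pderiv (sum f A) = (\<Sum>i\<in>A. pderiv (f i))"
  for f :: "'b \<Rightarrow> 'a::field_char_0 poly"
  by (induction A rule: infinite_finite_induct) (simp_all add: pderiv_add)

lemma pderiv_J: "pderiv (J a f) = f"
proof -
  have "pderiv (J a f) = (\<Sum>n\<le>degree f. monom (coeff f n) n)"
    unfolding J_def pderiv_sum_poly
    by (intro sum.cong refl)
      (simp add: pderiv_smult pderiv_diff pderiv_monom pderiv_singleton smult_monom
        del: of_nat_Suc of_nat_add)
  then show ?thesis by (simp add: poly_as_sum_of_monoms)
qed

lemma poly_J_base: "poly (J a f) a = 0"
  by (simp add: J_def poly_sum poly_monom)

lemma J_unique:
  assumes "pderiv p = f" "poly p a = 0"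
  shows "J a f = p"
proof -
  have "pderiv (J a f - p) = 0" by (simp add: pderiv_diff pderiv_J assms)
  then have "degree (J a f - p) = 0" by (simp only: pderiv_eq_0_iff)
  then obtain c where c: "J a f - p = [:c:]" by (rule degree_eq_zeroE)
  have "poly (J a f - p) a = 0" by (simp add: poly_J_base assms)
  with c have "c = 0" by simp
  with c show ?thesis by simp
qed

lemma J_add: "J a (f + g) = J a f + J a g"
  by (rule J_unique) (simp_all add: pderiv_add pderiv_J poly_J_base)

lemma J_smult: "J a (smult c f) = smult c (J a f)"
  by (rule J_unique) (simp_all add: pderiv_smult pderiv_J poly_J_base)

lemma J_monom:
  "J a (monom 1 n) = smult (inverse (of_nat (n + 1))) (monom 1 (n + 1) - [:a ^ (n + 1):])"
  by (rule J_unique)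
    (simp_all add: pderiv_smult pderiv_diff pderiv_monom smult_monom poly_monom
      del: of_nat_Suc of_nat_add)

lemma ex_poly_J_nonzero:
  fixes r :: "'a::field_char_0 poly"
  assumes "a \<noteq> b" "r \<noteq> 0"
  shows "\<exists>f. poly (J a (r * f)) b \<noteq> 0"
proof (rule ccontr)
  assume *: "\<not> ?thesis"
  define q where "q = pcompose r [:a, 1:]"
  define d where "d = degree q"
  define u where "u = [:-a, 1:]"
  define e where "e i = coeff q i * (b - a) ^ i" for i
  have "q \<noteq> 0" using assms by (simp add: q_def pcompose_eq_0_iff)
  have "pcompose q u = r"
    by (simp add: q_def u_def pcompose_pCons flip: pcompose_assoc)
  moreover have "pcompose q u = (\<Sum>i\<le>d. smult (coeff q i) (u ^ i))"
  proof -
    have "poly (pcompose q u) x = poly (\<Sum>i\<le>d. smult (coeff q i) (u ^ i)) x" for x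
      unfolding poly_pcompose poly_altdef[of q] d_def by (simp add: poly_sum)
    then show ?thesis by (auto simp: poly_eq_poly_eq_iff[symmetric])
  qed
  ultimately have r: "r = (\<Sum>i\<le>d. smult (coeff q i) (u ^ i))" by simp
  have sum0: "(\<Sum>i\<le>d. e i / of_nat (n + i + 1)) = 0" for n
  proof -
    let ?p = "\<Sum>i\<le>d. smult (coeff q i / of_nat (n + i + 1)) (u ^ (n + i + 1))"
    have "pderiv ?p = (\<Sum>i\<le>d. smult (coeff q i) (u ^ i) * u ^ n)"
      unfolding pderiv_sum_poly
    proof (intro sum.cong refl)
      fix i
      have "pderiv u = 1" by (simp add: u_def pderiv_pCons)
      then have "pderiv (u ^ (n + i + 1)) = smult (of_nat (n + i + 1)) (u ^ (n + i))"
        by (simp add: pderiv_power del: of_nat_Suc of_nat_add power_Suc)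
      then show "pderiv (smult (coeff q i / of_nat (n + i + 1)) (u ^ (n + i + 1)))
          = smult (coeff q i) (u ^ i) * u ^ n"
        by (simp add: pderiv_smult power_add mult_ac del: of_nat_Suc of_nat_add power_Suc)
    qed
    also have "\<dots> = r * u ^ n" by (simp add: r sum_distrib_right)
    finally have "J a (r * u ^ n) = ?p"
      by (rule J_unique) (simp add: poly_sum u_def)
    with * have "poly ?p b = 0" by metis
    moreover have "poly ?p b = (b - a) ^ (n + 1) * (\<Sum>i\<le>d. e i / of_nat (n + i + 1))"
      unfolding poly_sum sum_distrib_left
      by (intro sum.cong refl)
        (simp add: e_def u_def power_add algebra_simps diff_divide_distrib del: of_nat_Suc of_nat_add)
    ultimately show ?thesis using assms by simp
  qed
  define P where "P = (\<Sum>i\<le>d. smult (e i) (\<Prod>j\<in>{..d} - {i}. [:of_nat (j + 1), 1:]))"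
  have root: "poly P (of_nat n) = 0" for n
  proof -
    let ?w = "\<lambda>j. of_nat (n + j + 1) :: 'a"
    have "poly P (of_nat n) = (\<Sum>i\<le>d. e i * (\<Prod>j\<in>{..d} - {i}. ?w j))"
      by (simp add: P_def poly_sum poly_prod add_ac)
    also have "\<dots> = (\<Sum>i\<le>d. (\<Prod>j\<le>d. ?w j) * (e i / ?w i))"
    proof (intro sum.cong refl)
      fix i assume "i \<in> {..d}"
      then have "(\<Prod>j\<le>d. ?w j) = ?w i * (\<Prod>j\<in>{..d} - {i}. ?w j)"
        by (intro prod.remove) auto
      moreover have "?w i \<noteq> 0" by (simp del: of_nat_add of_nat_Suc)
      ultimately show "e i * (\<Prod>j\<in>{..d} - {i}. ?w j) = (\<Prod>j\<le>d. ?w j) * (e i / ?w i)"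
        by (simp add: field_simps del: of_nat_add of_nat_Suc)
    qed
    also have "\<dots> = (\<Prod>j\<le>d. ?w j) * (\<Sum>i\<le>d. e i / ?w i)"
      by (simp only: sum_distrib_left)
    finally show ?thesis by (simp only: sum0 mult_zero_right)
  qed
  have "P = 0"
  proof (rule ccontr)
    assume "P \<noteq> 0"
    then have "finite {x. poly P x = 0}" by (rule poly_roots_finite)
    then have "finite (range (of_nat :: nat \<Rightarrow> 'a))"
      by (rule finite_subset[rotated]) (auto simp: root)
    then show False by (auto dest: finite_imageD simp: inj_of_nat)
  qed
  then have "0 = poly P (- of_nat (d + 1))" by simp
  also have "\<dots> = (\<Sum>i\<le>d. e i * (\<Prod>j\<in>{..d} - {i}. of_nat j - of_nat d))"
    by (simp add: P_def poly_sum poly_prod)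
  also have "\<dots> = (\<Sum>i\<le>d. if i = d then e d * (\<Prod>j\<in>{..d} - {d}. of_nat j - of_nat d) else 0)"
    by (intro sum.cong refl) (auto intro!: prod_zero)
  also have "\<dots> = e d * (\<Prod>j\<in>{..d} - {d}. of_nat j - of_nat d)" by simp
  finally have "e d = 0" by auto
  then show False using \<open>q \<noteq> 0\<close> assms by (auto simp: e_def d_def)
qed

lemma inj_on_RB_params:
  "inj_on (\<lambda>(a, r). J a \<circ> lmult r) (UNIV \<times> (UNIV - {0 :: 'a::field_char_0 poly}))"
proof (rule inj_onI)
  fix x y :: "'a \<times> 'a poly"
  assume x: "x \<in> UNIV \<times> (UNIV - {0})"
    and xy: "(case x of (a, r) \<Rightarrow> J a \<circ> lmult r) = (case y of (a, r) \<Rightarrow> J a \<circ> lmult r)"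
  obtain a r b s where [simp]: "x = (a, r)" "y = (b, s)" by (metis surj_pair)
  have eq: "J a \<circ> lmult r = J b \<circ> lmult s" and "r \<noteq> 0" using x xy by auto
  have eq': "J a (r * f) = J b (s * f)" for f
    using fun_cong[OF eq, of f] by (simp add: lmult_def)
  then have "r = s" using eq'[of 1] by (metis mult_1_right pderiv_J)
  moreover have "a = b"
    using ex_poly_J_nonzero[of a b r] \<open>r \<noteq> 0\<close> eq' \<open>r = s\<close> poly_J_base[of b] by metis
  ultimately show "x = y" by simp
qed

lemma RB_params_eq: "r \<noteq> 0 \<Longrightarrow> RB_params (J a \<circ> lmult r) = (a, r)"
  unfolding RB_params_def
  using the_inv_into_f_f[OF inj_on_RB_params, of "(a, r)"] by simp

lemma RB_I: "r \<noteq> 0 \<Longrightarrow> J a \<circ> lmult r \<in> RB"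
  by (auto simp: RB_def)

lemma h_map_eq:
  "r \<noteq> 0 \<Longrightarrow> h_map b s (J a \<circ> lmult r) = J a \<circ> lmult (r + smult (poly r b) s)"
  by (simp add: h_map_def RB_I RB_params_eq)

lemma g_map_eq:
  "r \<noteq> 0 \<Longrightarrow> g_map \<nu> (J a \<circ> lmult r) = J (a - \<nu>) \<circ> lmult (pcompose r [:\<nu>, 1:])"
  by (simp add: g_map_def RB_I RB_params_eq)

lemma h_map_nonzero:
  fixes r :: "'a::field_char_0 poly"
  assumes "poly s b = 0" "r \<noteq> 0"
  shows "r + smult (poly r b) s \<noteq> 0"
proof
  assume *: "r + smult (poly r b) s = 0"
  have "poly (r + smult (poly r b) s) b = poly r b" using assms by simp
  with * have "poly r b = 0" by simp
  with * assms show False by simp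
qed

lemma h_map_Bij:
  assumes "poly s b = 0"
  shows "h_map b s \<in> Bij RB"
proof -
  have mem: "h_map b s T \<in> RB" if "T \<in> RB" "poly s b = 0" for T s
    using that by (auto simp: RB_def h_map_eq) (metis h_map_nonzero)
  have inv: "h_map b (- s) (h_map b s T) = T" if "T \<in> RB" "poly s b = 0" for T s
    using that by (auto simp: RB_def h_map_eq h_map_nonzero)
  have "bij_betw (h_map b s) RB RB"
    using assms inv[of _ s] inv[of _ "- s"] mem[of _ s] mem[of _ "- s"]
    by (intro bij_betw_byWitness[where f' = "h_map b (- s)"]) auto
  then show ?thesis by (simp add: Bij_def h_map_def)
qed

lemma g_map_g_map:
  assumes "T \<in> RB"
  shows "g_map \<mu> (g_map \<nu> T) = g_map (\<mu> + \<nu>) T"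
  using assms
  by (auto simp: RB_def g_map_eq pcompose_eq_0_iff pcompose_pCons algebra_simps
      simp flip: pcompose_assoc)

lemma g_map_Bij: "g_map \<nu> \<in> Bij RB"
proof -
  have mem: "g_map \<nu> T \<in> RB" if "T \<in> RB" for T \<nu>
    using that by (auto simp: RB_def g_map_eq) (metis pcompose_eq_0_iff degree_pCons_eq_if one_neq_zero pCons_eq_0_iff zero_less_Suc)
  have zero: "g_map 0 T = T" if "T \<in> RB" for T
    using that by (auto simp: RB_def g_map_eq)
  have "bij_betw (g_map \<nu>) RB RB"
    by (intro bij_betw_byWitness[where f' = "g_map (- \<nu>)"])
      (auto simp: mem g_map_g_map zero)
  then show ?thesis by (simp add: Bij_def g_map_def)
qed

end

theory Submission
  imports Defs
begin

text \<open>If two multipliers \<open>r\<close> and \<open>r'\<close> have the same nonzero value \<open>v\<close> at a point \<open>b\<close>, a single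
  generator of the group \<open>\<H>\<close> carries \<open>r\<close> to \<open>r'\<close>: the polynomial \<open>s = (r' - r) / v\<close> vanishes
  at \<open>b\<close>, and \<open>h\<^sup>b\<^sub>s\<close> adds exactly \<open>r' - r\<close> to \<open>r\<close>. Arbitrary nonzero multipliers are joined by
  two such steps. A field of characteristic zero is infinite, so there are distinct points \<open>b\<close>
  and \<open>c\<close> with \<open>r(b) \<noteq> 0\<close> and \<open>r'(c) \<noteq> 0\<close>, and the interpolating polynomial of degree at most
  one that agrees with \<open>r\<close> at \<open>b\<close> and with \<open>r'\<close> at \<open>c\<close> serves as the intermediate multiplier.
  Hence \<open>\<H>\<close> is already transitive on the operators with a given base point \<open>a\<close>. The
  translations in \<open>G\<^sub>a\<close> move any base point to any other, and what they do to the multiplier is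
  then corrected by \<open>\<H>\<close>.\<close>

text \<open>Knowing this for the group generated by \<open>G\<^sub>a\<close> and \<open>\<H>\<close>, it suffices to join any two elements
  by a chain of generators, because orbits are closed under composition of steps.\<close>

lemma group_action_generate_BijGroup:
  assumes "S \<subseteq> Bij E"
  shows "group_action ((BijGroup E)\<lparr>carrier := generate (BijGroup E) S\<rparr>) E (\<lambda>f. f)"
proof -
  interpret B: group "BijGroup E" by (rule group_BijGroup)
  have "subgroup (generate (BijGroup E) S) (BijGroup E)"
    using assms by (intro B.generate_is_subgroup) (simp add: BijGroup_def)
  then have "group_hom ((BijGroup E)\<lparr>carrier := generate (BijGroup E) S\<rparr>) (BijGroup E) id"
    by (rule B.canonical_inj_is_hom)
  then show ?thesis by (simp add: group_action_def id_def)
qed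

lemma H_group_subset_Bij: "H_group \<subseteq> Bij RB"
  using group.generate_incl[OF group_BijGroup, of "{h_map b s | b s. poly s b = 0}" RB]
    h_map_Bij
  by (auto simp: H_group_def BijGroup_def)

interpretation GH: group_action
    GH_group "RB :: ('a::field_char_0 poly \<Rightarrow> 'a poly) set" "\<lambda>T. T"
  unfolding GH_group_def
  by (rule group_action_generate_BijGroup)
    (use H_group_subset_Bij in \<open>auto simp: Ga_group_def g_map_Bij\<close>)

lemma h_map_in_GH_group: "poly s b = 0 \<Longrightarrow> h_map b s \<in> carrier GH_group"
  by (auto simp: GH_group_def H_group_def intro!: generate.incl)

lemma g_map_in_GH_group: "g_map \<nu> \<in> carrier GH_group"
  by (auto simp: GH_group_def Ga_group_def intro!: generate.incl)

lemma same_value_in_orbit: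
  fixes r r' :: "'a::field_char_0 poly"
  assumes "poly r b = poly r' b" "poly r b \<noteq> 0"
  shows "J a \<circ> lmult r' \<in> orbit GH_group (\<lambda>T. T) (J a \<circ> lmult r)"
proof -
  let ?s = "smult (inverse (poly r b)) (r' - r)"
  have "r \<noteq> 0" using assms by auto
  then have "h_map b ?s (J a \<circ> lmult r) = J a \<circ> lmult r'"
    using assms by (simp add: h_map_eq)
  moreover have "h_map b ?s \<in> carrier GH_group"
    using assms by (intro h_map_in_GH_group) simp
  ultimately show ?thesis unfolding orbit_def mem_Collect_eq by metis
qed

lemma nonroot_avoiding_finite_set:
  fixes p :: "'a::field_char_0 poly"
  assumes "p \<noteq> 0" "finite A"
  obtains x where "x \<notin> A" "poly p x \<noteq> 0"
proof -
  have "finite (A \<union> {x. poly p x = 0})"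
    using assms by (simp add: poly_roots_finite)
  then obtain x where "x \<notin> A \<union> {x. poly p x = 0}"
    using ex_new_if_finite[OF infinite_UNIV_char_0] by blast
  then show thesis using that by auto
qed

text \<open>The two multipliers may agree at no point, as distinct constants do, which is why the
  connection passes through an interpolating polynomial.\<close>

lemma same_base_point_in_orbit:
  fixes r r' :: "'a::field_char_0 poly"
  assumes "r \<noteq> 0" "r' \<noteq> 0"
  shows "J a \<circ> lmult r' \<in> orbit GH_group (\<lambda>T. T) (J a \<circ> lmult r)"
proof -
  obtain b where b: "poly r b \<noteq> 0"
    using nonroot_avoiding_finite_set[OF assms(1), of "{}"] by auto
  obtain c where c: "c \<noteq> b" "poly r' c \<noteq> 0"
    using nonroot_avoiding_finite_set[OF assms(2), of "{b}"] by auto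
  define m where "m = (poly r' c - poly r b) / (c - b)"
  define q where "q = [:poly r b:] + smult m [:- b, 1:]"
  have qb: "poly q b = poly r b" by (simp add: q_def)
  have "poly q c = poly r b + m * (c - b)"
    by (simp add: q_def algebra_simps)
  then have qc: "poly q c = poly r' c" using c by (simp add: m_def)
  have "q \<noteq> 0" using qb b by auto
  have "J a \<circ> lmult q \<in> orbit GH_group (\<lambda>T. T) (J a \<circ> lmult r)"
    using qb b by (intro same_value_in_orbit[where b = b]) simp_all
  moreover have "J a \<circ> lmult r' \<in> orbit GH_group (\<lambda>T. T) (J a \<circ> lmult q)"
    using qc c by (intro same_value_in_orbit[where b = c]) simp_all
  ultimately show ?thesis
    using assms \<open>q \<noteq> 0\<close> by (blast intro: GH.orbit_trans RB_I)
qed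

theorem proposition4p27:
  shows "transitive_action GH_group
    (RB :: ('a::field_char_0 poly \<Rightarrow> 'a poly) set) (\<lambda>T. T)"
proof
  fix T U :: "'a poly \<Rightarrow> 'a poly"
  assume "T \<in> RB" "U \<in> RB"
  then obtain a r b s where T: "T = J a \<circ> lmult r" "r \<noteq> 0" and U: "U = J b \<circ> lmult s" "s \<noteq> 0"
    by (auto simp: RB_def)
  let ?t = "pcompose r [:a - b, 1:]"
  have "?t \<noteq> 0" using T by (simp add: pcompose_eq_0_iff)
  have "g_map (a - b) T = J b \<circ> lmult ?t" using T by (simp add: g_map_eq)
  then have "J b \<circ> lmult ?t \<in> orbit GH_group (\<lambda>T. T) T"
    unfolding orbit_def mem_Collect_eq by (metis g_map_in_GH_group)
  moreover have "U \<in> orbit GH_group (\<lambda>T. T) (J b \<circ> lmult ?t)"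
    unfolding U using \<open>?t \<noteq> 0\<close> U by (intro same_base_point_in_orbit)
  ultimately have "U \<in> orbit GH_group (\<lambda>T. T) T"
    using \<open>T \<in> RB\<close> \<open>U \<in> RB\<close> \<open>?t \<noteq> 0\<close> by (blast intro: GH.orbit_trans RB_I)
  then show "\<exists>g \<in> carrier GH_group. g T = U" by (auto simp: orbit_def)
qed

end
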